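(* For every integer $r\ge 4$, the forgotten index of the third type of triangular hex derived network $THDN3(r)$ is $$F(THDN3(r))=12\,(990-997r+259r^2).$$
   Context: All graphs are finite, simple and undirected; $\kappa(p)$ denotes the degree of a vertex $p$ in a graph $G$. Triangular mesh of dimension $r$: the graph whose vertices are the triples $(x,y,z)$ of nonnegative integers with $x+y+z=r-1$, two vertices being adjacent iff their difference is a permutation of $(1,-1,0)$ (a triangular piece of the triangular lattice with $r$ vertices on each side). Third type of triangular hex derived network $THDN3(r)$: obtained from the triangular mesh of dimension $r$ by replacing each $K_3$ subgraph (triangle) by a planar octahedron, once. That is, for each triangle with vertices $a,b,c$, all edges of the triangle are kept, three new vertices $u_{ab},u_{bc},u_{ca}$ (private to that triangle) are added, the new vertices are made pairwise adjacent, and $u_{ab}$ is joined to $a$ and $b$, $u_{bc}$ to $b$ and $c$, $u_{ca}$ to $c$ and $a$. It has $\frac{7r^2-11r+6}{2}$ vertices. Forgotten index: $F(G)=\sum_{pq\in E(G)}\big(\kappa(p)^2+\kappa(q)^2\big)$. *)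

theory Defs
  imports Main "HOL-Library.Multiset"
begin

record 'a ugraph =
  verts :: "'a set"
  edges :: "'a set set"

definition simple_graph :: "'a ugraph \<Rightarrow> bool" where
  "simple_graph G \<longleftrightarrow> finite (verts G) \<and> edges G \<subseteq> {e. e \<subseteq> verts G \<and> card e = 2}"

definition degree :: "'a ugraph \<Rightarrow> 'a \<Rightarrow> nat" where
  "degree G p = card {e \<in> edges G. p \<in> e}"

text \<open>An edge is a two-element set, so the inner sum over \<open>e = {p, q}\<close> is
  \<open>(degree G p)\<^sup>2 + (degree G q)\<^sup>2\<close>.\<close>

definition forgotten_index :: "'a ugraph \<Rightarrow> nat" where
  "forgotten_index G = (\<Sum>e\<in>edges G. \<Sum>p\<in>e. (degree G p)\<^sup>2)"

type_synonym point = "nat \<times> nat \<times> nat"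

fun mesh_adj :: "point \<Rightarrow> point \<Rightarrow> bool" where
  "mesh_adj (x, y, z) (x', y', z') \<longleftrightarrow>
     mset [int x - int x', int y - int y', int z - int z'] = mset [1, -1, 0]"

definition triangular_mesh :: "nat \<Rightarrow> point ugraph" where
  "triangular_mesh r =
     (let V = {(x, y, z). x + y + z + 1 = r}
      in \<lparr>verts = V, edges = {{p, q} | p q. p \<in> V \<and> q \<in> V \<and> mesh_adj p q}\<rparr>)"

text \<open>Subgraphs isomorphic to \<open>K\<^sub>3\<close>, each given by its vertex set.\<close>

definition triangles :: "'a ugraph \<Rightarrow> 'a set set" where
  "triangles G = {T. T \<subseteq> verts G \<and> card T = 3 \<and> (\<forall>a\<in>T. \<forall>b\<in>T. a \<noteq> b \<longrightarrow> {a, b} \<in> edges G)}"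

definition sides :: "'a set \<Rightarrow> 'a set set" where
  "sides T = {s. s \<subseteq> T \<and> card s = 2}"

text \<open>\<open>New T {a, b}\<close> is the new vertex \<open>u\<^sub>a\<^sub>b\<close> private to the triangle \<open>T\<close>.\<close>

datatype 'a oct_vertex = Old 'a | New "'a set" "'a set"

definition replace_triangles :: "'a ugraph \<Rightarrow> 'a oct_vertex ugraph" where
  "replace_triangles G =
     \<lparr>verts = Old ` verts G \<union> {New T s | T s. T \<in> triangles G \<and> s \<in> sides T},
      edges = (\<lambda>e. Old ` e) ` edges G
        \<union> {{New T s, New T t} | T s t. T \<in> triangles G \<and> s \<in> sides T \<and> t \<in> sides T \<and> s \<noteq> t}
        \<union> {{Old a, New T s} | T s a. T \<in> triangles G \<and> s \<in> sides T \<and> a \<in> s}\<rparr>"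

definition THDN3 :: "nat \<Rightarrow> point oct_vertex ugraph" where
  "THDN3 r = replace_triangles (triangular_mesh r)"

lemma mesh_adj_imp_neq:
  assumes "mesh_adj p q"
  shows "p \<noteq> q"
proof
  assume "p = q"
  obtain x y z where p: "p = (x, y, z)" by (cases p)
  have "mset [0, 0, 0] = mset [1, -1, 0 :: int]"
    using assms unfolding \<open>p = q\<close>[symmetric] p by (simp only: mesh_adj.simps diff_self)
  then have "set [0, 0, 0] = set [1, -1, 0 :: int]"
    by (rule mset_eq_setD)
  then show False by auto
qed

lemma simple_graph_triangular_mesh: "simple_graph (triangular_mesh r)"
proof -
  define V where "V = {(x, y, z). x + y + z + 1 = r}"
  have "V \<subseteq> {..r} \<times> {..r} \<times> {..r}" by (auto simp: V_def)
  then have "finite V" by (rule finite_subset) simp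
  moreover have "card {p, q} = 2" if "mesh_adj p q" for p q
    using mesh_adj_imp_neq[OF that] by simp
  ultimately show ?thesis
    unfolding simple_graph_def triangular_mesh_def Let_def V_def[symmetric] ugraph.simps
    by blast
qed

lemma simple_graph_replace_triangles:
  assumes "simple_graph G"
  shows "simple_graph (replace_triangles G)"
proof -
  have fin: "finite (verts G)" using assms by (simp add: simple_graph_def)
  have "finite (triangles G)"
    by (rule finite_subset[of _ "Pow (verts G)"]) (use fin in \<open>auto simp: triangles_def\<close>)
  moreover have "finite (sides T)" if "T \<in> triangles G" for T
    by (rule finite_subset[of _ "Pow (verts G)"])
      (use fin that in \<open>auto simp: triangles_def sides_def\<close>)
  ultimately have "finite (\<Union>T\<in>triangles G. New T ` sides T)" by simp
  moreover have "{New T s | T s. T \<in> triangles G \<and> s \<in> sides T}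
      = (\<Union>T\<in>triangles G. New T ` sides T)" by blast
  ultimately have finN: "finite {New T s | T s. T \<in> triangles G \<and> s \<in> sides T}"
    by (simp only:)
  have card_Old: "card (Old ` e) = card e" for e :: "'a set"
    by (simp add: card_image inj_on_def)
  have side_in: "a \<in> verts G" if "T \<in> triangles G" "s \<in> sides T" "a \<in> s" for T s a
    using that by (auto simp: triangles_def sides_def)
  have "finite (Old ` verts G)" using fin by simp
  with finN have fin': "finite (verts (replace_triangles G))"
    unfolding replace_triangles_def ugraph.simps by (rule finite_UnI[rotated])
  have "e \<subseteq> verts (replace_triangles G) \<and> card e = 2" if e: "e \<in> edges (replace_triangles G)" for e
  proof -
    consider (old) e' where "e' \<in> edges G" "e = Old ` e'"
      | (new) T s t where "T \<in> triangles G" "s \<in> sides T" "t \<in> sides T" "s \<noteq> t"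
          "e = {New T s, New T t}"
      | (mixed) T s a where "T \<in> triangles G" "s \<in> sides T" "a \<in> s" "e = {Old a, New T s}"
      using e unfolding replace_triangles_def ugraph.simps
      by (elim UnE imageE CollectE exE conjE) assumption+
    then show ?thesis
    proof cases
      case old
      then have "e' \<subseteq> verts G" "card e' = 2"
        using assms by (auto simp: simple_graph_def)
      then have "Old ` e' \<subseteq> Old ` verts G" "card (Old ` e') = 2"
        by (simp_all only: image_mono card_Old)
      then show ?thesis
        unfolding old(2) replace_triangles_def ugraph.simps by blast
    next
      case new
      then have "card e = 2" by simp
      with new show ?thesis
        unfolding replace_triangles_def ugraph.simps by blast
    next
      case mixed
      then have "card e = 2" by simp
      with mixed side_in[OF mixed(1-3)] show ?thesis
        unfolding replace_triangles_def ugraph.simps by blast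
    qed
  qed
  with fin' show ?thesis by (auto simp: simple_graph_def)
qed

lemma simple_graph_THDN3: "simple_graph (THDN3 r)"
  unfolding THDN3_def
  by (intro simple_graph_replace_triangles simple_graph_triangular_mesh)

end

theory Submission
  imports Defs
begin

text \<open>
  Summing over edges the squares of the degrees of the end points counts each vertex once per
  incident edge, so the forgotten index is the sum of the cubes of the degrees
  (\<open>forgotten_index_eq_sum_cubes\<close>).  Hence it suffices to know how many vertices of each degree
  there are.

  Every new vertex of an octahedron has degree 4: its neighbours are the two other new vertices of
  its triangle and the two ends of its side.  An old vertex keeps its neighbours and gains two new
  ones in each triangle that contains it, one for each of the two sides of the triangle there.

  In the mesh with \<open>r \<ge> 3\<close> points on a side, both the degree of a vertex and the number of
  triangles containing it depend only on the number \<open>k\<close> of its nonzero coordinates.  A neighbour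
  arises by moving one unit from a nonzero coordinate to one of the two others, which gives degree
  \<open>2 * k\<close>.  The triangles are the sets \<open>b + {e\<^sub>1, e\<^sub>2, e\<^sub>3}\<close> and
  \<open>b + {e\<^sub>2 + e\<^sub>3, e\<^sub>1 + e\<^sub>3, e\<^sub>1 + e\<^sub>2}\<close> for the unit vectors \<open>e\<^sub>i\<close>
  (\<open>triangles_triangular_mesh\<close>).  Those of the first kind at a given vertex correspond to a choice
  of one nonzero coordinate and those of the second kind to a choice of two, so there are
  \<open>k + (k choose 2)\<close> of them.  The new degree is therefore \<open>4 * k + 2 * (k choose 2)\<close>, which is
  4 at the 3 corners, 10 at the \<open>3 * (r - 2)\<close> other boundary vertices, and 18 at the
  \<open>(r - 2) choose 2\<close> interior ones.  As there are \<open>(r - 1)\<^sup>2\<close> triangles, the forgotten index is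
  \<open>3 * 4^3 + 3 * (r - 2) * 10^3 + ((r - 2) choose 2) * 18^3 + 3 * (r - 1)\<^sup>2 * 4^3\<close>.
\<close>

section \<open>Degrees in a simple graph\<close>

definition neighbours :: "'a ugraph \<Rightarrow> 'a \<Rightarrow> 'a set" where
  "neighbours G p = {q. {p, q} \<in> edges G}"

lemma edge_ends:
  assumes "simple_graph G" "{p, q} \<in> edges G"
  shows "p \<noteq> q" "p \<in> verts G" "q \<in> verts G"
proof -
  have "{p, q} \<subseteq> verts G" "card {p, q} = 2"
    using assms by (auto simp: simple_graph_def)
  then show "p \<noteq> q" "p \<in> verts G" "q \<in> verts G" by auto
qed

lemma finite_edges: "simple_graph G \<Longrightarrow> finite (edges G)"
  by (rule finite_subset[of _ "Pow (verts G)"]) (auto simp: simple_graph_def)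

lemma finite_neighbours: "simple_graph G \<Longrightarrow> finite (neighbours G p)"
  by (rule finite_subset[of _ "verts G"])
    (auto simp: neighbours_def simple_graph_def dest: edge_ends)

lemma degree_eq_card_neighbours:
  assumes "simple_graph G"
  shows "degree G p = card (neighbours G p)"
proof -
  have "{e \<in> edges G. p \<in> e} = (\<lambda>q. {p, q}) ` neighbours G p"
  proof (intro equalityI subsetI)
    fix e assume e: "e \<in> {e \<in> edges G. p \<in> e}"
    then have "card e = 2" using assms by (auto simp: simple_graph_def)
    then obtain a b where "e = {a, b}" by (auto simp: card_2_iff)
    with e show "e \<in> (\<lambda>q. {p, q}) ` neighbours G p"
      by (auto simp: neighbours_def insert_commute)
  qed (auto simp: neighbours_def)
  moreover have "inj_on (\<lambda>q. {p, q}) (neighbours G p)"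
    by (auto simp: inj_on_def doubleton_eq_iff)
  ultimately show ?thesis by (simp add: degree_def card_image)
qed

lemma forgotten_index_eq_sum_cubes:
  assumes "simple_graph G"
  shows "forgotten_index G = (\<Sum>p\<in>verts G. degree G p ^ 3)"
proof -
  have fin: "finite (verts G)" "finite (edges G)"
    using assms finite_edges by (auto simp: simple_graph_def)
  have "forgotten_index G = (\<Sum>e\<in>edges G. \<Sum>p\<in>{p \<in> verts G. p \<in> e}. (degree G p)\<^sup>2)"
    unfolding forgotten_index_def
    by (intro sum.cong refl) (use assms in \<open>auto simp: simple_graph_def\<close>)
  also have "\<dots> = (\<Sum>p\<in>verts G. \<Sum>e\<in>{e \<in> edges G. p \<in> e}. (degree G p)\<^sup>2)"
    using fin by (intro sum.swap_restrict) auto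
  also have "\<dots> = (\<Sum>p\<in>verts G. degree G p ^ 3)"
    by (simp add: degree_def[symmetric] power3_eq_cube power2_eq_square mult.assoc)
  finally show ?thesis .
qed

section \<open>Replacing triangles by octahedra\<close>

definition triangles_at :: "'a ugraph \<Rightarrow> 'a \<Rightarrow> 'a set set" where
  "triangles_at G a = {T \<in> triangles G. a \<in> T}"

lemma finite_triangles: "simple_graph G \<Longrightarrow> finite (triangles G)"
  by (rule finite_subset[of _ "Pow (verts G)"]) (auto simp: triangles_def simple_graph_def)

lemma card_triangle:
  assumes "T \<in> triangles G"
  shows "card T = 3" "finite T"
  using assms by (auto simp: triangles_def intro: card_ge_0_finite)

lemma card_sides:
  assumes "T \<in> triangles G"
  shows "card (sides T) = 3" "finite (sides T)"
proof -
  show "card (sides T) = 3"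
    using n_subsets[of T 2] card_triangle[OF assms] by (simp add: sides_def eval_nat_numeral)
  then show "finite (sides T)" by (intro card_ge_0_finite) simp
qed

text \<open>A side of \<open>T\<close> through \<open>a\<close> is determined by its other end.\<close>

lemma card_sides_at:
  assumes "T \<in> triangles G" "a \<in> T"
  shows "card {s \<in> sides T. a \<in> s} = 2"
proof -
  have "{s \<in> sides T. a \<in> s} = (\<lambda>b. {a, b}) ` (T - {a})"
    using assms(2) by (auto simp: sides_def card_2_iff)
  moreover have "inj_on (\<lambda>b. {a, b}) (T - {a})"
    by (auto simp: inj_on_def doubleton_eq_iff)
  ultimately show ?thesis
    using card_triangle[OF assms(1)] assms(2) by (simp add: card_image)
qed

lemma doubleton_in_edges_replace_triangles:
  "{Old a, Old b} \<in> edges (replace_triangles G) \<longleftrightarrow> {a, b} \<in> edges G"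
  "{Old a, New T s} \<in> edges (replace_triangles G) \<longleftrightarrow> T \<in> triangles G \<and> s \<in> sides T \<and> a \<in> s"
  "{New T s, Old a} \<in> edges (replace_triangles G) \<longleftrightarrow> T \<in> triangles G \<and> s \<in> sides T \<and> a \<in> s"
  "{New T s, New T' t} \<in> edges (replace_triangles G) \<longleftrightarrow>
     T' = T \<and> T \<in> triangles G \<and> s \<in> sides T \<and> t \<in> sides T \<and> s \<noteq> t"
proof -
  have *: "{Old a, Old b} = Old ` e \<longleftrightarrow> e = {a, b}" for e :: "'a set" and a b
  proof -
    have "{Old a, Old b} = Old ` {a, b}" by simp
    moreover have "Old ` {a, b} = Old ` e \<longleftrightarrow> {a, b} = e"
      by (rule inj_image_eq_iff) (simp add: inj_on_def)
    ultimately show ?thesis by (simp only: eq_commute[of e])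
  qed
  have **: "{Old a, New T s} \<noteq> Old ` e" "{New T s, Old a} \<noteq> Old ` e"
    "{New T s, New T' t} \<noteq> Old ` e" for e :: "'a set" and a T s T' t
    by (auto dest!: equalityD1)
  have E: "e \<in> edges (replace_triangles G) \<longleftrightarrow> (\<exists>e'\<in>edges G. e = Old ` e')
      \<or> (\<exists>T s t. e = {New T s, New T t} \<and> T \<in> triangles G \<and> s \<in> sides T \<and> t \<in> sides T \<and> s \<noteq> t)
      \<or> (\<exists>T s a. e = {Old a, New T s} \<and> T \<in> triangles G \<and> s \<in> sides T \<and> a \<in> s)" for e
    unfolding replace_triangles_def ugraph.simps by (simp only: Un_iff image_iff mem_Collect_eq disj_assoc)
  show
  "{Old a, Old b} \<in> edges (replace_triangles G) \<longleftrightarrow> {a, b} \<in> edges G"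
  "{Old a, New T s} \<in> edges (replace_triangles G) \<longleftrightarrow> T \<in> triangles G \<and> s \<in> sides T \<and> a \<in> s"
  "{New T s, Old a} \<in> edges (replace_triangles G) \<longleftrightarrow> T \<in> triangles G \<and> s \<in> sides T \<and> a \<in> s"
  "{New T s, New T' t} \<in> edges (replace_triangles G) \<longleftrightarrow>
     T' = T \<and> T \<in> triangles G \<and> s \<in> sides T \<and> t \<in> sides T \<and> s \<noteq> t"
    unfolding E by (auto simp: * ** doubleton_eq_iff)
qed

text \<open>
  The new neighbours of \<open>a\<close> are indexed by the pairs of a triangle at \<open>a\<close> and one of its two sides
  through \<open>a\<close>; different triangles contribute different vertices, even when they share a side.
\<close>

lemma degree_replace_triangles_Old:
  assumes "simple_graph G"
  shows "degree (replace_triangles G) (Old a) = degree G a + 2 * card (triangles_at G a)"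
proof -
  let ?H = "replace_triangles G"
  let ?P = "Sigma (triangles_at G a) (\<lambda>T. {s \<in> sides T. a \<in> s})"
  have split: "neighbours ?H (Old a) = Old ` neighbours G a \<union> (\<lambda>(T, s). New T s) ` ?P"
  proof (rule set_eqI)
    fix v show "v \<in> neighbours ?H (Old a) \<longleftrightarrow> v \<in> Old ` neighbours G a \<union> (\<lambda>(T, s). New T s) ` ?P"
      by (cases v) (auto simp: neighbours_def doubleton_in_edges_replace_triangles triangles_at_def sides_def)
  qed
  have fin: "finite (triangles_at G a)"
    using finite_triangles[OF assms] by (simp add: triangles_at_def)
  have fins: "\<forall>T\<in>triangles_at G a. finite {s \<in> sides T. a \<in> s}"
    by (auto simp: triangles_at_def card_sides(2)[THEN finite_subset[rotated]])
  have "card (neighbours ?H (Old a))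
      = card (Old ` neighbours G a) + card ((\<lambda>(T, s). New T s) ` ?P)"
    unfolding split using finite_neighbours[OF assms] fin fins
    by (intro card_Un_disjoint finite_imageI finite_SigmaI) auto
  also have "card (Old ` neighbours G a) = degree G a"
    by (simp add: degree_eq_card_neighbours[OF assms] card_image inj_on_def)
  also have "card ((\<lambda>(T, s). New T s) ` ?P) = card ?P"
    by (intro card_image) (auto simp: inj_on_def)
  also have "\<dots> = (\<Sum>T\<in>triangles_at G a. card {s \<in> sides T. a \<in> s})"
    using fin fins by (rule card_SigmaI)
  also have "\<dots> = (\<Sum>T\<in>triangles_at G a. 2)"
    by (intro sum.cong refl card_sides_at) (auto simp: triangles_at_def)
  finally show ?thesis
    by (simp add: degree_eq_card_neighbours simple_graph_replace_triangles assms)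
qed

lemma degree_replace_triangles_New:
  assumes "simple_graph G" "T \<in> triangles G" "s \<in> sides T"
  shows "degree (replace_triangles G) (New T s) = 4"
proof -
  let ?H = "replace_triangles G"
  have split: "neighbours ?H (New T s) = Old ` s \<union> New T ` (sides T - {s})"
  proof (rule set_eqI)
    fix v show "v \<in> neighbours ?H (New T s) \<longleftrightarrow> v \<in> Old ` s \<union> New T ` (sides T - {s})"
      using assms by (cases v) (auto simp: neighbours_def doubleton_in_edges_replace_triangles)
  qed
  have s: "card s = 2" "finite s"
    using assms(3) by (auto simp: sides_def intro: card_ge_0_finite)
  have "card (neighbours ?H (New T s)) = card (Old ` s) + card (New T ` (sides T - {s}))"
    unfolding split using s card_sides[OF assms(2)] by (intro card_Un_disjoint) auto
  also have "\<dots> = 4"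
    using s card_sides[OF assms(2)] assms(3) by (simp add: card_image inj_on_def)
  finally show ?thesis
    by (simp add: degree_eq_card_neighbours simple_graph_replace_triangles assms)
qed

text \<open>
  Each triangle contributes three new vertices of degree 4, that is \<open>3 * 4^3 = 192\<close>.
\<close>

lemma forgotten_index_replace_triangles:
  assumes "simple_graph G"
  shows "forgotten_index (replace_triangles G)
    = (\<Sum>a\<in>verts G. (degree G a + 2 * card (triangles_at G a)) ^ 3) + 192 * card (triangles G)"
proof -
  let ?H = "replace_triangles G" and ?P = "Sigma (triangles G) sides"
  let ?new = "\<lambda>(T, s). New T s"
  have verts: "verts ?H = Old ` verts G \<union> ?new ` ?P"
    by (auto simp: replace_triangles_def)
  have fin: "finite (verts G)" "finite ?P"
    using assms finite_triangles[OF assms] card_sides(2) by (auto simp: simple_graph_def)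
  have "forgotten_index ?H = (\<Sum>v\<in>verts ?H. degree ?H v ^ 3)"
    by (intro forgotten_index_eq_sum_cubes simple_graph_replace_triangles assms)
  also have "\<dots> = (\<Sum>v\<in>Old ` verts G. degree ?H v ^ 3) + (\<Sum>v\<in>?new ` ?P. degree ?H v ^ 3)"
    unfolding verts using fin by (intro sum.union_disjoint finite_imageI) auto
  also have "(\<Sum>v\<in>Old ` verts G. degree ?H v ^ 3)
      = (\<Sum>a\<in>verts G. (degree G a + 2 * card (triangles_at G a)) ^ 3)"
    by (subst sum.reindex) (auto simp: inj_on_def degree_replace_triangles_Old[OF assms])
  also have "(\<Sum>v\<in>?new ` ?P. degree ?H v ^ 3) = (\<Sum>v\<in>?new ` ?P. 4 ^ 3)"
    by (intro sum.cong refl) (auto simp: degree_replace_triangles_New[OF assms])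
  also have "\<dots> = 64 * card ?P"
    by (subst sum.reindex) (auto simp: inj_on_def)
  also have "card ?P = (\<Sum>T\<in>triangles G. card (sides T))"
    using finite_triangles[OF assms] card_sides(2) by (intro card_SigmaI) auto
  also have "\<dots> = 3 * card (triangles G)"
    by (simp add: card_sides(1))
  finally show ?thesis by simp
qed

section \<open>Degrees and triangles in the triangular mesh\<close>

definition lattice_simplex :: "nat \<Rightarrow> point set" where
  "lattice_simplex n = {(x, y, z). x + y + z = n}"

text \<open>
  The two orientations of a triangle in the lattice, each given by its coordinatewise minimum.
\<close>

fun up :: "point \<Rightarrow> point set" where
  "up (x, y, z) = {(Suc x, y, z), (x, Suc y, z), (x, y, Suc z)}"

fun down :: "point \<Rightarrow> point set" where
  "down (x, y, z) = {(x, Suc y, Suc z), (Suc x, y, Suc z), (Suc x, Suc y, z)}"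

fun support_size :: "point \<Rightarrow> nat" where
  "support_size (x, y, z) = of_bool (x > 0) + of_bool (y > 0) + of_bool (z > 0)"

text \<open>
  The six permutations of \<open>(1, -1, 0)\<close>, in a subtraction-free form that case distinctions on
  natural number coordinates can use directly.
\<close>

lemma mesh_adj_iff:
  "mesh_adj (x, y, z) (x', y', z') \<longleftrightarrow>
     x = Suc x' \<and> y' = Suc y \<and> z = z' \<or> x = Suc x' \<and> y = y' \<and> z' = Suc z \<or>
     x' = Suc x \<and> y = Suc y' \<and> z = z' \<or> x = x' \<and> y = Suc y' \<and> z' = Suc z \<or>
     x' = Suc x \<and> y = y' \<and> z = Suc z' \<or> x = x' \<and> y' = Suc y \<and> z = Suc z'"
  (is "_ \<longleftrightarrow> ?R")
proof
  assume "mesh_adj (x, y, z) (x', y', z')"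
  then have "set [int x - int x', int y - int y', int z - int z'] = set [1, -1, 0]"
    by (simp only: mesh_adj.simps) (rule mset_eq_setD)
  then obtain i j k where ijk: "{i, j, k} = {1, -1, 0}"
    "i = int x - int x'" "j = int y - int y'" "k = int z - int z'"
    by simp
  have all: "1 \<in> {i, j, k}" "-1 \<in> {i, j, k}" "0 \<in> {i, j, k}"
    using ijk(1) by blast+
  have "i \<in> {1, -1, 0}" "j \<in> {1, -1, 0}" "k \<in> {1, -1, 0}"
    using ijk(1) by blast+
  then have "i = 1 \<and> j = -1 \<and> k = 0 \<or> i = 1 \<and> j = 0 \<and> k = -1 \<or>
      i = -1 \<and> j = 1 \<and> k = 0 \<or> i = 0 \<and> j = 1 \<and> k = -1 \<or>
      i = -1 \<and> j = 0 \<and> k = 1 \<or> i = 0 \<and> j = -1 \<and> k = 1"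
    by (elim insertE emptyE; insert all; simp)
  moreover have "int m - int n = 1 \<longleftrightarrow> m = Suc n" "int m - int n = -1 \<longleftrightarrow> n = Suc m"
    "int m - int n = 0 \<longleftrightarrow> m = n" for m n
    by linarith+
  ultimately show ?R unfolding ijk(2-4) by (simp only:)
next
  assume ?R
  then show "mesh_adj (x, y, z) (x', y', z')"
    by (elim disjE conjE) (simp_all add: add_mset_commute)
qed

declare mesh_adj.simps [simp del]

lemma verts_triangular_mesh: "verts (triangular_mesh (Suc n)) = lattice_simplex n"
  by (auto simp: triangular_mesh_def lattice_simplex_def)

lemma mesh_adj_sym: "mesh_adj p q \<longleftrightarrow> mesh_adj q p"
  by (cases p; cases q) (auto simp: mesh_adj_iff)

lemma doubleton_in_edges_triangular_mesh:
  "{p, q} \<in> edges (triangular_mesh (Suc n)) \<longleftrightarrow>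
     p \<in> lattice_simplex n \<and> q \<in> lattice_simplex n \<and> mesh_adj p q"
proof -
  have "edges (triangular_mesh (Suc n))
      = {{p, q} | p q. p \<in> lattice_simplex n \<and> q \<in> lattice_simplex n \<and> mesh_adj p q}"
    by (simp add: triangular_mesh_def Let_def lattice_simplex_def)
  then show ?thesis
    by (simp only: mem_Collect_eq doubleton_eq_iff) (use mesh_adj_sym in blast)
qed

text \<open>
  Every nonzero coordinate can pass one unit to either of the two other coordinates.
\<close>

lemma degree_triangular_mesh:
  assumes "p \<in> lattice_simplex n"
  shows "degree (triangular_mesh (Suc n)) p = 2 * support_size p"
proof -
  obtain x y z where p: "p = (x, y, z)" by (cases p)
  have n: "x + y + z = n" using assms by (simp add: p lattice_simplex_def)
  have "neighbours (triangular_mesh (Suc n)) p =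
      (if x > 0 then {(x - 1, Suc y, z), (x - 1, y, Suc z)} else {}) \<union>
      (if y > 0 then {(Suc x, y - 1, z), (x, y - 1, Suc z)} else {}) \<union>
      (if z > 0 then {(Suc x, y, z - 1), (x, Suc y, z - 1)} else {})"
    (is "_ = ?R")
  proof (rule set_eqI)
    fix q :: point
    obtain x' y' z' where q: "q = (x', y', z')" by (cases q)
    have "q \<in> neighbours (triangular_mesh (Suc n)) p \<longleftrightarrow> x' + y' + z' = n \<and> mesh_adj p q"
      using n by (simp add: neighbours_def doubleton_in_edges_triangular_mesh p q lattice_simplex_def)
    also have "\<dots> \<longleftrightarrow> q \<in> ?R"
      using n unfolding p q mesh_adj_iff by (cases x; cases y; cases z; auto)
    finally show "q \<in> neighbours (triangular_mesh (Suc n)) p \<longleftrightarrow> q \<in> ?R" .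
  qed
  then show ?thesis
    by (cases x; cases y; cases z)
      (simp_all add: degree_eq_card_neighbours simple_graph_triangular_mesh p)
qed

text \<open>
  Three times the centroid of a triangle.  It determines the base point, and its residues modulo 3
  tell the two orientations apart.
\<close>

definition coord_sums :: "point set \<Rightarrow> nat \<times> nat \<times> nat" where
  "coord_sums T = (\<Sum>p\<in>T. fst p, \<Sum>p\<in>T. fst (snd p), \<Sum>p\<in>T. snd (snd p))"

lemma coord_sums_up_down:
  "coord_sums (up (x, y, z)) = (3 * x + 1, 3 * y + 1, 3 * z + 1)"
  "coord_sums (down (x, y, z)) = (3 * x + 2, 3 * y + 2, 3 * z + 2)"
  by (simp_all add: coord_sums_def)

lemma up_eq_iff: "up p = up q \<longleftrightarrow> p = q"
proof
  assume "up p = up q"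
  then have "coord_sums (up p) = coord_sums (up q)" by (rule arg_cong)
  then show "p = q" by (cases p; cases q) (simp add: coord_sums_up_down del: up.simps)
qed simp

lemma down_eq_iff: "down p = down q \<longleftrightarrow> p = q"
proof
  assume "down p = down q"
  then have "coord_sums (down p) = coord_sums (down q)" by (rule arg_cong)
  then show "p = q" by (cases p; cases q) (simp add: coord_sums_up_down del: down.simps)
qed simp

lemma up_neq_down: "up p \<noteq> down q"
proof
  assume *: "up p = down q"
  obtain x y z x' y' z' where pq: "p = (x, y, z)" "q = (x', y', z')" by (cases p; cases q)
  have "3 * x + 1 = 3 * x' + 2"
    using arg_cong[OF *, of coord_sums] by (simp only: pq coord_sums_up_down prod.inject)
  then show False by presburger
qed

text \<open>
  Take the coordinatewise minimum of the three points as base point.  Coordinates of adjacent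
  points differ by at most 1, so each point exceeds the base by 0 or 1 in every coordinate.  Adjacent
  points have equal coordinate sums, so the number of ones is the same for all three; it is one or
  two because the points are distinct.  There are only three such points for each of these numbers,
  so the triangle consists of all of them.
\<close>

lemma mutually_adjacent_up_or_down:
  assumes adj: "mesh_adj p q" "mesh_adj p s" "mesh_adj q s"
  shows "\<exists>b. {p, q, s} = up b \<or> {p, q, s} = down b"
proof -
  obtain x y z x' y' z' x'' y'' z'' where
    c: "p = (x, y, z)" "q = (x', y', z')" "s = (x'', y'', z'')"
    by (cases p; cases q; cases s)
  define a1 a2 a3 where
    a: "a1 = min x (min x' x'')" "a2 = min y (min y' y'')" "a3 = min z (min z' z'')"
  have "{p, q, s} \<subseteq> up (a1, a2, a3) \<or> {p, q, s} \<subseteq> down (a1, a2, a3)"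
    using adj(1) unfolding c mesh_adj_iff
    by (elim disjE conjE; insert adj(2)[unfolded c mesh_adj_iff];
        elim disjE conjE; insert adj(3)[unfolded c mesh_adj_iff]; clarsimp simp: a min_def)
  moreover have "{p, q, s} = T" if "{p, q, s} \<subseteq> T" "card T = 3" for T
  proof -
    have "card {p, q, s} = 3"
      using mesh_adj_imp_neq[OF adj(1)] mesh_adj_imp_neq[OF adj(2)] mesh_adj_imp_neq[OF adj(3)]
      by simp
    then show ?thesis
      using card_subset_eq[OF _ that(1)] that(2) by (simp add: card_ge_0_finite)
  qed
  moreover have "card (up (a1, a2, a3)) = 3" "card (down (a1, a2, a3)) = 3" by simp_all
  ultimately have "{p, q, s} = up (a1, a2, a3) \<or> {p, q, s} = down (a1, a2, a3)"
    by blast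
  then show ?thesis by (rule exI)
qed

lemma triangles_triangular_mesh:
  "triangles (triangular_mesh (Suc (Suc (Suc n))))
     = up ` lattice_simplex (Suc n) \<union> down ` lattice_simplex n" (is "?L = ?R")
proof (intro equalityI subsetI)
  fix T assume "T \<in> ?R"
  then show "T \<in> ?L"
    by (auto simp: triangles_def verts_triangular_mesh doubleton_in_edges_triangular_mesh mesh_adj_iff
        lattice_simplex_def)
next
  fix T assume T: "T \<in> ?L"
  then obtain p q s where pqs: "T = {p, q, s}" "p \<noteq> q" "p \<noteq> s" "q \<noteq> s"
    by (auto simp: triangles_def card_3_iff)
  have "mesh_adj p q" "mesh_adj p s" "mesh_adj q s" and p: "p \<in> lattice_simplex (Suc (Suc n))"
    using T pqs by (auto simp: triangles_def doubleton_in_edges_triangular_mesh verts_triangular_mesh)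
  then obtain b where b: "T = up b \<or> T = down b"
    using mutually_adjacent_up_or_down pqs(1) by blast
  have "p \<in> T" using pqs(1) by simp
  from b show "T \<in> ?R"
  proof
    assume T: "T = up b"
    then have "b \<in> lattice_simplex (Suc n)"
      using \<open>p \<in> T\<close> p by (cases b) (auto simp: lattice_simplex_def)
    then show ?thesis unfolding T by (intro UnI1 imageI)
  next
    assume T: "T = down b"
    then have "b \<in> lattice_simplex n"
      using \<open>p \<in> T\<close> p by (cases b) (auto simp: lattice_simplex_def)
    then show ?thesis unfolding T by (intro UnI2 imageI)
  qed
qed

text \<open>
  The base point of a triangle at \<open>p\<close> arises by lowering one nonzero coordinate of \<open>p\<close> for
  \<open>up\<close>, and two of them for \<open>down\<close>.
\<close>

lemma triangles_at_triangular_mesh: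
  assumes "p \<in> lattice_simplex (Suc (Suc n))"
  shows "card (triangles_at (triangular_mesh (Suc (Suc (Suc n)))) p)
    = support_size p + (support_size p choose 2)"
proof -
  obtain x y z where p: "p = (x, y, z)" by (cases p)
  have n: "x + y + z = Suc (Suc n)" using assms by (simp add: p lattice_simplex_def)
  have "triangles_at (triangular_mesh (Suc (Suc (Suc n)))) p =
      (if x > 0 then {up (x - 1, y, z)} else {}) \<union>
      (if y > 0 then {up (x, y - 1, z)} else {}) \<union>
      (if z > 0 then {up (x, y, z - 1)} else {}) \<union>
      (if y > 0 \<and> z > 0 then {down (x, y - 1, z - 1)} else {}) \<union>
      (if x > 0 \<and> z > 0 then {down (x - 1, y, z - 1)} else {}) \<union>
      (if x > 0 \<and> y > 0 then {down (x - 1, y - 1, z)} else {})" (is "_ = ?R")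
  proof (intro equalityI subsetI)
    fix T assume "T \<in> triangles_at (triangular_mesh (Suc (Suc (Suc n)))) p"
    then obtain b where pT: "p \<in> T" and T: "T = up b \<or> T = down b"
      unfolding triangles_at_def triangles_triangular_mesh by blast
    obtain b1 b2 b3 where b: "b = (b1, b2, b3)" by (cases b)
    from T show "T \<in> ?R"
    proof
      assume T: "T = up b"
      then have "x = Suc b1 \<and> y = b2 \<and> z = b3 \<or> x = b1 \<and> y = Suc b2 \<and> z = b3
          \<or> x = b1 \<and> y = b2 \<and> z = Suc b3"
        using pT by (simp add: p b)
      then show ?thesis by (elim disjE) (simp_all add: T b del: up.simps down.simps)
    next
      assume T: "T = down b"
      then have "x = b1 \<and> y = Suc b2 \<and> z = Suc b3 \<or> x = Suc b1 \<and> y = b2 \<and> z = Suc b3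
          \<or> x = Suc b1 \<and> y = Suc b2 \<and> z = b3"
        using pT by (simp add: p b)
      then show ?thesis by (elim disjE) (simp_all add: T b del: up.simps down.simps)
    qed
  next
    fix T assume T: "T \<in> ?R"
    have "T \<in> up ` lattice_simplex (Suc n) \<union> down ` lattice_simplex n"
      using T n by (force simp: lattice_simplex_def simp del: up.simps down.simps split: if_splits)
    moreover have "p \<in> T" using T by (auto simp: p split: if_splits)
    ultimately show "T \<in> triangles_at (triangular_mesh (Suc (Suc (Suc n)))) p"
      by (simp add: triangles_at_def triangles_triangular_mesh)
  qed
  then show ?thesis
    by (cases x; cases y; cases z)
      (simp_all add: up_eq_iff down_eq_iff up_neq_down up_neq_down[symmetric] p eval_nat_numeral
        del: up.simps down.simps)
qed

section \<open>Counting lattice points\<close>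

lemma finite_lattice_simplex: "finite (lattice_simplex n)"
  by (rule finite_subset[of _ "{..n} \<times> {..n} \<times> {..n}"]) (auto simp: lattice_simplex_def)

text \<open>
  Points with positive first coordinate are translates of the points of the previous simplex; the
  others form a single row.
\<close>

lemma card_lattice_simplex: "card (lattice_simplex n) = (n + 2) choose 2"
proof (induction n)
  case 0
  have "lattice_simplex 0 = {(0, 0, 0)}" by (auto simp: lattice_simplex_def)
  then show ?case by (simp add: eval_nat_numeral)
next
  case (Suc n)
  let ?f = "\<lambda>(x, y, z). (Suc x, y, z)" and ?g = "\<lambda>y. (0, y, Suc n - y) :: point"
  have "lattice_simplex (Suc n) = ?f ` lattice_simplex n \<union> ?g ` {..Suc n}"
  proof (rule set_eqI)
    fix p :: point
    obtain x y z where p: "p = (x, y, z)" by (cases p)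
    show "p \<in> lattice_simplex (Suc n) \<longleftrightarrow> p \<in> ?f ` lattice_simplex n \<union> ?g ` {..Suc n}"
      unfolding p by (cases x) (auto simp: lattice_simplex_def image_iff)
  qed
  moreover have "card (?f ` lattice_simplex n \<union> ?g ` {..Suc n})
      = card (?f ` lattice_simplex n) + card (?g ` {..Suc n})"
    by (intro card_Un_disjoint finite_imageI finite_lattice_simplex) auto
  moreover have "card (?f ` lattice_simplex n) = card (lattice_simplex n)"
    by (intro card_image) (auto simp: inj_on_def)
  moreover have "card (?g ` {..Suc n}) = card {..Suc n}"
    by (intro card_image) (auto simp: inj_on_def)
  ultimately show ?case using Suc by (simp add: eval_nat_numeral)
qed

text \<open>
  The simplex splits into its three corners, its three open edges and its interior; subtracting 1
  from every coordinate turns the interior into a smaller simplex.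
\<close>

lemma sum_support_size:
  fixes f :: "nat \<Rightarrow> nat"
  shows "(\<Sum>p\<in>lattice_simplex (m + 3). f (support_size p))
    = 3 * f 1 + 3 * (m + 2) * f 2 + ((m + 2) choose 2) * f 3"
proof -
  let ?n = "m + 3"
  let ?C = "{(?n, 0, 0), (0, ?n, 0), (0, 0, ?n)} :: point set"
  let ?X = "(\<lambda>i. (0, Suc i, Suc m - i + 1)) ` {..Suc m} :: point set"
  let ?Y = "(\<lambda>i. (Suc i, 0, Suc m - i + 1)) ` {..Suc m} :: point set"
  let ?Z = "(\<lambda>i. (Suc i, Suc m - i + 1, 0)) ` {..Suc m} :: point set"
  let ?I = "(\<lambda>(x, y, z). (Suc x, Suc y, Suc z)) ` lattice_simplex m"
  have split: "lattice_simplex ?n = ?C \<union> (?X \<union> (?Y \<union> (?Z \<union> ?I)))"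
  proof (rule set_eqI)
    fix p :: point
    obtain x y z where p: "p = (x, y, z)" by (cases p)
    show "p \<in> lattice_simplex ?n \<longleftrightarrow> p \<in> ?C \<union> (?X \<union> (?Y \<union> (?Z \<union> ?I)))"
      unfolding p by (cases x; cases y; cases z) (auto simp: lattice_simplex_def image_iff)
  qed
  let ?F = "\<lambda>p. f (support_size p)"
  have "sum ?F (lattice_simplex ?n) = sum ?F ?C + (sum ?F ?X + (sum ?F ?Y + (sum ?F ?Z + sum ?F ?I)))"
  proof -
    have "sum ?F (?Z \<union> ?I) = sum ?F ?Z + sum ?F ?I"
      by (intro sum.union_disjoint) (auto simp: finite_lattice_simplex)
    moreover have "sum ?F (?Y \<union> (?Z \<union> ?I)) = sum ?F ?Y + sum ?F (?Z \<union> ?I)"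
      by (intro sum.union_disjoint) (auto simp: finite_lattice_simplex)
    moreover have "sum ?F (?X \<union> (?Y \<union> (?Z \<union> ?I))) = sum ?F ?X + sum ?F (?Y \<union> (?Z \<union> ?I))"
      by (intro sum.union_disjoint) (auto simp: finite_lattice_simplex)
    moreover have "sum ?F (?C \<union> (?X \<union> (?Y \<union> (?Z \<union> ?I))))
        = sum ?F ?C + sum ?F (?X \<union> (?Y \<union> (?Z \<union> ?I)))"
      by (intro sum.union_disjoint) (auto simp: finite_lattice_simplex)
    ultimately show ?thesis by (simp only: split)
  qed
  moreover have "sum ?F ?C = 3 * f 1" by simp
  moreover have "sum ?F ?X = (m + 2) * f 2" "sum ?F ?Y = (m + 2) * f 2" "sum ?F ?Z = (m + 2) * f 2"
    by (subst sum.reindex; auto simp: inj_on_def numeral_2_eq_2)+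
  moreover have "sum ?F ?I = ((m + 2) choose 2) * f 3"
    by (subst sum.reindex) (auto simp: inj_on_def split_def numeral_3_eq_3 card_lattice_simplex)
  ultimately show ?thesis by (simp add: algebra_simps)
qed

lemma card_triangles_triangular_mesh:
  "card (triangles (triangular_mesh (Suc (Suc (Suc n))))) = (n + 2)\<^sup>2"
proof -
  have "card (triangles (triangular_mesh (Suc (Suc (Suc n)))))
      = card (up ` lattice_simplex (Suc n)) + card (down ` lattice_simplex n)"
    unfolding triangles_triangular_mesh
    by (intro card_Un_disjoint finite_imageI finite_lattice_simplex) (auto simp: up_neq_down simp del: up.simps down.simps)
  also have "\<dots> = (n + 3 choose 2) + (n + 2 choose 2)"
    by (simp add: card_image inj_on_def up_eq_iff down_eq_iff card_lattice_simplex numeral_3_eq_3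
        del: up.simps down.simps)
  also have "\<dots> = (n + 2)\<^sup>2"
    by (induction n) (auto simp: eval_nat_numeral)
  finally show ?thesis .
qed

theorem theorem2p2p1:
  fixes r :: nat
  assumes "r \<ge> 4"
  shows "int (forgotten_index (THDN3 r)) = 12 * (990 - 997 * int r + 259 * (int r)\<^sup>2)"
proof -
  \<comment> \<open>The interior points of the mesh form a translate of \<open>lattice_simplex m\<close>.\<close>
  obtain m where "r = 4 + m" using assms le_Suc_ex by blast
  then have r: "r = Suc (m + 3)" by simp
  let ?M = "triangular_mesh (Suc (m + 3))"
  have deg: "degree ?M p + 2 * card (triangles_at ?M p) = 4 * support_size p + 2 * (support_size p choose 2)"
    if "p \<in> lattice_simplex (m + 3)" for p
    using that degree_triangular_mesh[of p "m + 3"] triangles_at_triangular_mesh[of p "Suc m"]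
    by (simp add: numeral_3_eq_3)
  have "forgotten_index (THDN3 r)
      = (\<Sum>p\<in>lattice_simplex (m + 3). (4 * support_size p + 2 * (support_size p choose 2)) ^ 3)
        + 192 * card (triangles ?M)"
    unfolding THDN3_def r
    unfolding forgotten_index_replace_triangles[OF simple_graph_triangular_mesh] verts_triangular_mesh
    by (intro arg_cong2[where f = plus] sum.cong refl) (simp only: deg)
  also have "card (triangles ?M) = (m + 3)\<^sup>2"
    using card_triangles_triangular_mesh[of "Suc m"] by (simp add: numeral_3_eq_3)
  also have "(\<Sum>p\<in>lattice_simplex (m + 3). (4 * support_size p + 2 * (support_size p choose 2)) ^ 3)
      = 192 + 3000 * (m + 2) + 5832 * ((m + 2) choose 2)"
  proof -
    have "Suc 0 choose 2 = 0" "(2::nat) choose 2 = 1" "(3::nat) choose 2 = 3"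
      by (simp_all add: eval_nat_numeral)
    note choose = this
    show ?thesis
      by (simp add: choose sum_support_size[where f = "\<lambda>k. (4 * k + 2 * (k choose 2)) ^ 3"])
  qed
  finally have F: "forgotten_index (THDN3 r)
      = 192 + 3000 * (m + 2) + 5832 * ((m + 2) choose 2) + 192 * (m + 3)\<^sup>2" .
  define c where "c = (m + 2) choose 2"
  have "2 * c = (m + 2) * (m + 1)"
    unfolding c_def by (induction m) (auto simp: eval_nat_numeral)
  then have "int (2 * c) = int ((m + 2) * (m + 1))" by (rule arg_cong)
  then have "2 * int c = (int m + 2) * (int m + 1)" by (simp add: algebra_simps)
  then have "5832 * int c = 2916 * ((int m + 2) * (int m + 1))" by linarith
  then show ?thesis unfolding F unfolding c_def[symmetric] r
    by (simp add: power2_eq_square algebra_simps)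
qed

end
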